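(* For every natural number $l\ge 1$, the set $$K_l=\left\{\sum_{i=1}^{\infty}\frac{\varepsilon_i}{(2l+2)^i} : (\varepsilon_i)_{i\ge 1}\in T_l^{\mathbb{N}}\right\},\qquad T_l=\{0,2,4,\dots,2l\}\cup\{2l+1,2l+3,\dots,4l+1\},$$ is a Cantorval.
   Context: $T_l$ has $2l+2$ elements: the even integers from $0$ to $2l$ and the odd integers from $2l+1$ to $4l+1$. A Cantorval (M-Cantorval) is a subset of $\mathbb{R}$ homeomorphic to $C\cup\bigcup_{n=1}^{\infty}G_{2n-1}$ (equivalently $[0,1]\setminus\bigcup_{n=1}^\infty G_{2n}$), where $C$ is the Cantor ternary set and $G_n$ is the union of the $2^{n-1}$ open middle thirds removed from $[0,1]$ at the $n$-th step of the construction of $C$. *)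

theory Defs
  imports "HOL-Analysis.Analysis"
begin

text \<open>A pair \<open>(a, b)\<close> stands for the closed interval \<open>{a..b}\<close>; \<open>cantor_intervals n\<close> consists of
  the intervals that are left after \<open>n\<close> steps of the middle-thirds construction.\<close>

fun cantor_intervals :: "nat \<Rightarrow> (real \<times> real) set" where
  "cantor_intervals 0 = {(0, 1)}"
| "cantor_intervals (Suc n) =
     (\<Union>(a, b)\<in>cantor_intervals n. {(a, a + (b - a) / 3), (b - (b - a) / 3, b)})"

definition cantor_set :: "real set" where
  "cantor_set = (\<Inter>n. \<Union>(a, b)\<in>cantor_intervals n. {a..b})"

text \<open>The open middle thirds removed at step \<open>n\<close>. Steps are counted from 1; the value at 0 is junk.\<close>

definition cantor_gaps :: "nat \<Rightarrow> real set" where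
  "cantor_gaps n =
     (\<Union>(a, b)\<in>cantor_intervals (n - 1). {a + (b - a) / 3 <..< b - (b - a) / 3})"

definition cantorval :: "real set \<Rightarrow> bool" where
  "cantorval X \<longleftrightarrow> X homeomorphic (cantor_set \<union> (\<Union>n\<in>{1..}. cantor_gaps (2 * n - 1)))"

definition digits_T :: "nat \<Rightarrow> nat set" where
  "digits_T l = {t. even t \<and> t \<le> 2 * l} \<union> {t. odd t \<and> 2 * l + 1 \<le> t \<and> t \<le> 4 * l + 1}"

text \<open>The sequences are indexed from 1, so \<open>\<epsilon> 0\<close> is irrelevant.\<close>

definition K_set :: "nat \<Rightarrow> real set" where
  "K_set l = {(\<Sum>i. real (\<epsilon> (Suc i)) / real (2 * l + 2) ^ Suc i) | \<epsilon>. \<forall>i\<ge>1. \<epsilon> i \<in> digits_T l}"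

lemma summable_K_set:
  assumes "\<forall>i\<ge>1. \<epsilon> i \<in> digits_T l"
  shows "summable (\<lambda>i. real (\<epsilon> (Suc i)) / real (2 * l + 2) ^ Suc i)"
proof (rule summable_comparison_test')
  show "summable (\<lambda>i. real (4 * l + 1) * (1 / real (2 * l + 2)) ^ Suc i)"
    by (intro summable_mult) (subst summable_Suc_iff, simp)
  fix i :: nat
  have "\<epsilon> (Suc i) \<in> digits_T l"
    using assms by simp
  then have "\<epsilon> (Suc i) \<le> 4 * l + 1"
    by (auto simp: digits_T_def)
  then have "real (\<epsilon> (Suc i)) \<le> real (4 * l + 1)"
    by (rule of_nat_mono)
  then have "real (\<epsilon> (Suc i)) / real (2 * l + 2) ^ Suc i \<le> real (4 * l + 1) / real (2 * l + 2) ^ Suc i"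
    by (rule divide_right_mono) simp
  then show "norm (real (\<epsilon> (Suc i)) / real (2 * l + 2) ^ Suc i)
      \<le> real (4 * l + 1) * (1 / real (2 * l + 2)) ^ Suc i"
    by (simp only: real_norm_def abs_of_nonneg[OF divide_nonneg_nonneg] of_nat_0_le_iff
        zero_le_power power_one_over) (simp add: divide_inverse)
qed

end

theory Submission
  imports Defs
begin

text \<open>A nonempty compact set \<open>X\<close> that is the closure of its interior is a Cantorval as soon as it
  nowhere coincides locally with a closed half-line. Indeed, every endpoint of a component of the
  interior or of a gap is then approached, from its other side, by both kinds of components.
  Starting from the convex hull, one can therefore remove alternately an interval of \<open>X\<close> and a gap
  of \<open>X\<close> from the inside of each remaining block, always one of nearly maximal length, and these
  removed intervals become dense. Removing middle thirds produces the same binary tree for the model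
  set, so matching the removed intervals extends to an increasing homeomorphism.

  \<open>K\<^sub>l\<close> is compact, self-similar with ratio \<open>1 / (2 l + 2)\<close>, and symmetric. The digits form a
  complete residue system modulo \<open>2 l + 2\<close>, hence the integer translates of \<open>K\<^sub>l\<close> cover the line
  and \<open>K\<^sub>l\<close> has interior points, which self-similarity makes dense. A local half-line, magnified,
  would show that \<open>K\<^sub>l\<close> contains \<open>{0<..<1}\<close>, but it omits numbers just below \<open>2 / (2 l + 2)\<close>.\<close>

section \<open>Binary trees of intervals\<close>

text \<open>Words are read from the last letter to the first: \<open>e # w\<close> is a child of \<open>w\<close>. The block
  \<open>{L w..R w}\<close> loses the open interval from \<open>c w\<close> to \<open>d w\<close>.\<close>

locale interval_tree =
  fixes L c d R :: "bool list \<Rightarrow> real"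
  assumes less: "L w < c w" "c w < d w" "d w < R w"
    and left: "L (False # w) = L w" "R (False # w) = c w"
    and right: "L (True # w) = d w" "R (True # w) = R w"
begin

lemma subtree: "L w \<le> L (u @ w)" "R (u @ w) \<le> R w"
proof -
  have "L w \<le> L (u @ w) \<and> R (u @ w) \<le> R w"
  proof (induction u)
    case (Cons x u)
    then show ?case
      using less[of "u @ w"] by (cases x) (auto simp: left right)
  qed simp
  then show "L w \<le> L (u @ w)" "R (u @ w) \<le> R w" by auto
qed

text \<open>Induction along the path to \<open>v\<close>. A point of the gap of \<open>w\<close>
  lies strictly inside each block on the way to that gap, and the gap of a node separates its two
  children, so the paths to \<open>w\<close> and to \<open>v\<close> cannot part before
  \<open>v\<close> is reached.\<close>

lemma gap_meets_block:
  assumes "c w < x" "x < d w" "L v \<le> x" "x \<le> R v"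
  shows "\<exists>u. w = u @ v"
  using assms(3,4)
proof (induction v)
  case (Cons e v)
  have "L v \<le> x" "x \<le> R v"
    using Cons.prems subtree(1)[of v "[e]"] subtree(2)[of "[e]" v] by auto
  then obtain u where u: "w = u @ v"
    using Cons.IH by blast
  show ?case
  \<comment> \<open>The last letter of \<open>u\<close> is the first turn taken below
    \<open>v\<close>, hence the split from the right. If \<open>u\<close> is empty, the gap is that
    of \<open>v\<close> itself and misses both children.\<close>
  proof (cases u rule: rev_cases)
    case Nil
    then show ?thesis
      using Cons.prems assms(1,2) u by (cases e) (auto simp: left right)
  next
    case (snoc u' e')
    then have w: "w = u' @ e' # v" using u by simp
    have "L (e' # v) < x" "x < R (e' # v)"
      using subtree(1)[of "e' # v" u'] subtree(2)[of u' "e' # v"] less[of w] assms(1,2) w by auto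
    then have "e' = e"
      using Cons.prems less[of v] by (cases e; cases e') (auto simp: left right)
    then show ?thesis using w by auto
  qed
qed simp

lemma gaps_disjoint:
  assumes "c w < x" "x < d w" "c v < x" "x < d v"
  shows "w = v"
proof -
  have "L v \<le> x" "x \<le> R v" "L w \<le> x" "x \<le> R w"
    using assms less[of v] less[of w] by auto
  then obtain u u' where "w = u @ v" "v = u' @ w"
    using gap_meets_block assms by blast
  then show ?thesis by auto
qed

text \<open>An interval that no gap meets falls wholly into one child at every node. If blocks are
  known to shrink, this gives density of the gaps; the case \<open>x = y\<close> describes the
  points outside all gaps.\<close>

lemma block_avoiding_gaps:
  assumes "L [] \<le> x" "x \<le> y" "y \<le> R []" "\<And>w. y \<le> c w \<or> d w \<le> x"
  shows "\<exists>w. length w = n \<and> L w \<le> x \<and> y \<le> R w"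
proof (induction n)
  case (Suc n)
  then obtain w where w: "length w = n" "L w \<le> x" "y \<le> R w" by auto
  show ?case
  proof (cases "y \<le> c w")
    case True
    then show ?thesis using w by (intro exI[of _ "False # w"]) (auto simp: left)
  next
    case False
    then show ?thesis using w assms(4)[of w] by (intro exI[of _ "True # w"]) (auto simp: right)
  qed
qed (use assms in auto)

lemma block_avoiding_gap_point:
  assumes "L [] \<le> x" "x \<le> R []" "\<And>w. \<not> (c w < x \<and> x < d w)"
  shows "\<exists>w. length w = n \<and> L w \<le> x \<and> x \<le> R w"
  using assms by (intro block_avoiding_gaps) (auto simp: not_less)

end

section \<open>Linear order of the gaps\<close>

text \<open>The order in which an in-order traversal visits the nodes of the tree.\<close>

definition word_less :: "bool list \<Rightarrow> bool list \<Rightarrow> bool" where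
  "word_less w v \<longleftrightarrow> w \<noteq> v \<and>
     (\<exists>z. (w = z \<or> (\<exists>u. w = u @ False # z)) \<and> (v = z \<or> (\<exists>u. v = u @ True # z)))"

lemma word_less_append:
  assumes "word_less w v"
  shows "word_less (w @ z) (v @ z)"
proof -
  obtain y where "w = y \<or> (\<exists>u. w = u @ False # y)" "v = y \<or> (\<exists>u. v = u @ True # y)" "w \<noteq> v"
    using assms by (auto simp: word_less_def)
  then show ?thesis
    unfolding word_less_def by (intro conjI exI[of _ "y @ z"]) auto
qed

text \<open>Induction from the end of the words, where the paths start: a common last letter is
  stripped off, and different last letters are compared at the node \<open>[]\<close>.\<close>

lemma word_less_total: "w \<noteq> v \<Longrightarrow> word_less w v \<or> word_less v w"
proof (induction w arbitrary: v rule: rev_induct)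
  case Nil
  then obtain u e where "v = u @ [e]" by (cases v rule: rev_cases) auto
  then show ?case by (cases e) (auto simp: word_less_def)
next
  case (snoc a w)
  show ?case
  proof (cases v rule: rev_cases)
    case Nil
    then show ?thesis by (cases a) (auto simp: word_less_def)
  next
    case (snoc v' e)
    show ?thesis
    proof (cases "a = e")
      case True
      then have "word_less w v' \<or> word_less v' w"
        using snoc.prems snoc snoc.IH by auto
      then show ?thesis using word_less_append snoc True by blast
    next
      case False
      then have "word_less (w @ [False]) (v' @ [True]) \<and> e \<or> word_less (v' @ [False]) (w @ [True]) \<and> a"
        unfolding word_less_def by auto
      then show ?thesis using False snoc by (cases a; cases e) auto
    qed
  qed
qed

text \<open>The node \<open>z\<close> is where the two paths part. Its gap has the block containing
  the gap of \<open>w\<close> on its left and the one containing the gap of \<open>v\<close> on its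
  right, unless one of them is the gap of \<open>z\<close>.\<close>

lemma (in interval_tree) word_less_gaps:
  assumes "word_less w v"
  shows "d w \<le> c v"
proof -
  obtain z where z: "w = z \<or> (\<exists>u. w = u @ False # z)" "v = z \<or> (\<exists>u. v = u @ True # z)" "w \<noteq> v"
    using assms by (auto simp: word_less_def)
  have A: "d w \<le> c z" if "w = u @ False # z" for u
    using subtree(2)[of u "False # z"] less(3)[of w] that by (simp add: left)
  have B: "d z \<le> c v" if "v = u @ True # z" for u
    using subtree(1)[of "True # z" u] less(1)[of v] that by (simp add: right)
  show ?thesis
    using z A B less(2)[of z] by force
qed

section \<open>Increasing homeomorphisms from matched gaps\<close>

text \<open>The extension is a supremum over the points of \<open>D\<close> to the left. Density of
  \<open>D\<close> makes it strictly increasing, density of the values of \<open>f\<close> makes it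
  onto.\<close>

lemma strict_mono_on_dense_extension:
  fixes f :: "real \<Rightarrow> real"
  assumes D: "D \<subseteq> {a..b}" and fD: "f ` D \<subseteq> {a'..b'}"
    and mono: "strict_mono_on D f"
    and dense: "\<And>x y. a \<le> x \<Longrightarrow> x < y \<Longrightarrow> y \<le> b \<Longrightarrow> \<exists>z\<in>D. x < z \<and> z < y"
    and dense': "\<And>x y. a' \<le> x \<Longrightarrow> x < y \<Longrightarrow> y \<le> b' \<Longrightarrow> \<exists>z\<in>D. x < f z \<and> f z < y"
    and ab: "a \<le> b" "a' \<le> b'"
  obtains h where "strict_mono_on {a..b} h" "h ` {a..b} = {a'..b'}" "\<And>x. x \<in> D \<Longrightarrow> h x = f x"
proof -
  \<comment> \<open>Inserting \<open>a'\<close> keeps the set nonempty where no point of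
    \<open>D\<close> lies to the left of \<open>x\<close>, and it does not exceed any value of
    \<open>f\<close>.\<close>
  define h where "h x = Sup (insert a' (f ` (D \<inter> {..x})))" for x
  have bdd: "bdd_above (insert a' (f ` (D \<inter> {..x})))" for x
    using fD by (intro bdd_aboveI[of _ b']) (use ab in auto)
  have f_le: "f y \<le> f z" if "y \<in> D" "z \<in> D" "y \<le> z" for y z
    using mono that strict_mono_onD[OF mono, of y z] by (cases "y = z") auto
  have ge: "f z \<le> h x" if "z \<in> D" "z \<le> x" for z x
    unfolding h_def using that bdd by (intro cSup_upper) auto
  have le: "h x \<le> f z" if "z \<in> D" "x \<le> z" for z x
    unfolding h_def using that fD by (intro cSup_least) (auto intro!: f_le)
  have range: "a' \<le> h x" "h x \<le> b'" for x
    unfolding h_def using bdd[of x] fD ab by (auto intro!: cSup_upper cSup_least)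
  have ext: "h x = f x" if "x \<in> D" for x
    using ge[of x x] le[of x x] that by simp
  have smono: "strict_mono_on {a..b} h"
  proof (rule strict_mono_onI)
    fix x y assume xy: "x \<in> {a..b}" "y \<in> {a..b}" "x < y"
    then obtain z where z: "z \<in> D" "x < z" "z < y" using dense[of x y] by auto
    \<comment> \<open>Comparison with points of \<open>D\<close> gives only weak inequalities;
      strictness comes from a second point of \<open>D\<close> between \<open>x\<close> and
      \<open>y\<close>.\<close>
    then obtain z' where z': "z' \<in> D" "z < z'" "z' < y" using dense[of z y] xy by auto
    have "h x \<le> f z" "f z' \<le> h y" using z z' by (auto intro: le ge)
    moreover have "f z < f z'" using mono z z' by (auto dest: strict_mono_onD)
    ultimately show "h x < h y" by simp
  qed
  have "t \<in> h ` {a..b}" if t: "t \<in> {a'..b'}" for t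
  proof -
    define x where "x = Sup (insert a {y\<in>D. f y \<le> t})"
    have bdd': "bdd_above (insert a {y\<in>D. f y \<le> t})"
      using D ab by (intro bdd_aboveI[of _ b]) auto
    have "x \<in> {a..b}"
      unfolding x_def using D ab bdd' by (auto intro!: cSup_upper cSup_least)
    moreover have "\<not> h x < t"
    proof
      assume "h x < t"
      then obtain z where z: "z \<in> D" "h x < f z" "f z < t"
        using dense'[of "h x" t] range[of x] t by auto
      then have "z \<le> x" unfolding x_def using bdd' by (intro cSup_upper) auto
      then show False using ge[of z x] z by simp
    qed
    moreover have "\<not> t < h x"
    proof
      assume "t < h x"
      then obtain z where z: "z \<in> D" "t < f z" "f z < h x"
        using dense'[of t "h x"] range[of x] t by auto
      then have "y \<le> z" if "y \<in> D" "f y \<le> t" for y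
        using f_le[of z y] that by force
      then have "x \<le> z" unfolding x_def using z D by (intro cSup_least) auto
      then show False using le[of z x] z by simp
    qed
    ultimately show ?thesis by force
  qed
  then have "h ` {a..b} = {a'..b'}" using range by auto
  with smono ext show ?thesis using that by blast
qed

text \<open>A monotone map with open image is continuous. To have an open image, \<open>h\<close> is
  prolonged with slope one on both sides to a monotone surjection \<open>H\<close> of the
  line.\<close>

lemma strict_mono_on_interval_continuous:
  fixes h :: "real \<Rightarrow> real"
  assumes "strict_mono_on {a..b} h" "h ` {a..b} = {a'..b'}" "a \<le> b"
  shows "continuous_on {a..b} h"
proof -
  have mono: "h x \<le> h y" if "x \<in> {a..b}" "y \<in> {a..b}" "x \<le> y" for x y
    using strict_mono_onD[OF assms(1), of x y] that by (cases "x = y") auto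
  have ran: "h x \<in> {a'..b'}" if "x \<in> {a..b}" for x using assms that by blast
  have "a' \<le> b'" using ran[of a] assms by auto
  then have "a' \<in> h ` {a..b}" "b' \<in> h ` {a..b}" using assms(2) by auto
  then have ha: "h a = a'" "h b = b'"
    using mono ran assms(3) by (force intro!: antisym)+
  define H where "H x = (if x < a then x - a + a' else if x \<le> b then h x else x - b + b')" for x
  have "surj H"
  proof (intro surjI)
    fix y
    show "H (if y < a' then y - a' + a else if y \<le> b' then (SOME x. x \<in> {a..b} \<and> h x = y) else y - b' + b) = y"
    proof -
      consider "y < a'" | "y \<in> {a'..b'}" | "b' < y" by fastforce
      then show ?thesis
      proof cases
        case 2
        then have "\<exists>x. x \<in> {a..b} \<and> h x = y" using assms(2) by force
        from someI_ex[OF this] show ?thesis using 2 by (auto simp: H_def)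
      qed (use \<open>a' \<le> b'\<close> assms(3) in \<open>auto simp: H_def\<close>)
    qed
  qed
  moreover have "H x \<le> H y" if "x \<le> y" for x y
    using that mono[of x y] ran[of x] ran[of y] assms(3) \<open>a' \<le> b'\<close> by (auto simp: H_def)
  ultimately have "continuous_on UNIV H"
    by (intro continuous_onI_mono) auto
  then have "continuous_on {a..b} H" by (rule continuous_on_subset) simp
  then show ?thesis by (rule continuous_on_cong[THEN iffD1, rotated 2]) (auto simp: H_def)
qed

text \<open>The two inequalities say that the open interval from \<open>x\<close> to
  \<open>y\<close> meets the gap of \<open>w\<close>, since both intervals are
  nondegenerate.\<close>

locale dense_interval_tree = interval_tree +
  assumes dense: "\<lbrakk>L [] \<le> x; x < y; y \<le> R []\<rbrakk> \<Longrightarrow> \<exists>w. c w < y \<and> x < d w"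

text \<open>Each gap is mapped affinely onto the gap with the same word. The words alone determine
  the order of the gaps in either tree, so this map is increasing, and it extends because the gaps
  are dense on both sides.\<close>

lemma dense_interval_trees_homeomorphism:
  assumes "dense_interval_tree L c d R" "dense_interval_tree L' c' d' R'"
  obtains h where "continuous_on {L []..R []} h" "inj_on h {L []..R []}"
    "h ` {L []..R []} = {L' []..R' []}"
    "\<And>w x. x \<in> {L []..R []} \<Longrightarrow> h x \<in> {c' w<..<d' w} \<longleftrightarrow> x \<in> {c w<..<d w}"
proof -
  interpret A: dense_interval_tree L c d R by fact
  interpret B: dense_interval_tree L' c' d' R' by fact
  define D where "D = (\<Union>w. {c w<..<d w})"
  define g where "g w x = c' w + (x - c w) / (d w - c w) * (d' w - c' w)" for w x
  \<comment> \<open>The word is unique because distinct gaps are disjoint; outside the gaps the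
    value is arbitrary.\<close>
  define f where "f x = g (THE w. c w < x \<and> x < d w) x" for x
  have f: "f x = g w x" if "c w < x" "x < d w" for w x
  proof -
    have "(THE w. c w < x \<and> x < d w) = w"
      using that by (intro the_equality) (auto intro: A.gaps_disjoint)
    then show ?thesis by (simp add: f_def)
  qed
  have g_mono: "g w x < g w y" if "x < y" for w x y
    using that A.less[of w] B.less[of w]
    by (auto simp: g_def intro!: mult_strict_right_mono divide_strict_right_mono)
  have g_ends: "g w (c w) = c' w" "g w (d w) = d' w" for w
    using A.less[of w] by (auto simp: g_def)
  have g_range: "c' w < g w x \<and> g w x < d' w" if "c w < x" "x < d w" for w x
    using g_mono[of "c w" x w] g_mono[of x "d w" w] g_ends that by auto
  have f_range: "c' w < f x \<and> f x < d' w" if "c w < x" "x < d w" for w x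
    using f g_range that by auto
  have g_onto: "\<exists>x. c w < x \<and> x < d w \<and> f x = y" if "c' w < y" "y < d' w" for w y
  proof -
    define x where "x = c w + (y - c' w) / (d' w - c' w) * (d w - c w)"
    have "(y - c' w) / (d' w - c' w) * (d w - c w) < 1 * (d w - c w)"
      using that A.less[of w] B.less[of w] by (intro mult_strict_right_mono) auto
    moreover have "(y - c' w) / (d' w - c' w) * (d w - c w) > 0"
      using that A.less[of w] B.less[of w] by auto
    ultimately have x: "c w < x" "x < d w" by (auto simp: x_def)
    moreover have "g w x = y"
      using A.less[of w] B.less[of w] by (simp add: g_def x_def)
    ultimately show ?thesis using f by auto
  qed
  have in_blocks: "L [] \<le> L w" "R w \<le> R []" "L' [] \<le> L' w" "R' w \<le> R' []" for w
    using A.subtree(1)[of "[]" w] A.subtree(2)[of w "[]"]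
      B.subtree(1)[of "[]" w] B.subtree(2)[of w "[]"] by auto
  have D: "D \<subseteq> {L []..R []}"
  proof
    fix x assume "x \<in> D"
    then obtain w where "c w < x" "x < d w" by (auto simp: D_def)
    then show "x \<in> {L []..R []}" using A.less[of w] in_blocks[of w] by auto
  qed
  have fD: "f ` D \<subseteq> {L' []..R' []}"
  proof
    fix y assume "y \<in> f ` D"
    then obtain x w where "c w < x" "x < d w" "y = f x" by (auto simp: D_def)
    then show "y \<in> {L' []..R' []}" using B.less[of w] in_blocks[of w] f_range[of w x] by auto
  qed
  have mono: "strict_mono_on D f"
  proof (rule strict_mono_onI)
    fix x y assume "x \<in> D" "y \<in> D" "x < y"
    then obtain w v where w: "c w < x" "x < d w" and v: "c v < y" "y < d v"
      by (auto simp: D_def)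
    show "f x < f y"
    proof (cases "w = v")
      case True
      then show ?thesis using f[OF w] f[OF v] g_mono \<open>x < y\<close> by auto
    next
      case False
      then have "word_less w v"
        using word_less_total[of w v] A.word_less_gaps[of v w] w v \<open>x < y\<close> by auto
      then show ?thesis using B.word_less_gaps[of w v] f_range[OF w] f_range[OF v] by auto
    qed
  qed
  have dense: "\<exists>z\<in>D. x < z \<and> z < y" if xy: "L [] \<le> x" "x < y" "y \<le> R []" for x y
  proof -
    obtain w where w: "c w < y" "x < d w" using A.dense xy by blast
    then obtain z where "max x (c w) < z" "z < min y (d w)"
      using dense[of "max x (c w)" "min y (d w)"] A.less[of w] xy by auto
    then show ?thesis by (auto simp: D_def intro!: bexI[of _ z])
  qed
  have dense': "\<exists>z\<in>D. x < f z \<and> f z < y" if xy: "L' [] \<le> x" "x < y" "y \<le> R' []" for x y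
  proof -
    obtain w where w: "c' w < y" "x < d' w" using B.dense xy by blast
    then obtain t where t: "max x (c' w) < t" "t < min y (d' w)"
      using Orderings.dense[of "max x (c' w)" "min y (d' w)"] B.less[of w] xy by auto
    then obtain z where "c w < z" "z < d w" "f z = t" using g_onto[of w t] by auto
    then show ?thesis using t by (auto simp: D_def intro!: bexI[of _ z])
  qed
  have le: "L [] \<le> R []" "L' [] \<le> R' []" using A.less[of "[]"] B.less[of "[]"] by auto
  obtain h where h: "strict_mono_on {L []..R []} h" "h ` {L []..R []} = {L' []..R' []}"
      "\<And>x. x \<in> D \<Longrightarrow> h x = f x"
    using strict_mono_on_dense_extension[OF D fD mono dense dense' le] by blast
  have inj: "inj_on h {L []..R []}" using h(1) by (rule strict_mono_on_imp_inj_on)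
  have "h x \<in> {c' w<..<d' w} \<longleftrightarrow> x \<in> {c w<..<d w}" if x: "x \<in> {L []..R []}" for w x
  proof
    assume "x \<in> {c w<..<d w}"
    moreover from this have "x \<in> D" unfolding D_def by blast
    ultimately show "h x \<in> {c' w<..<d' w}" using h(3)[of x] f_range[of w x] by simp
  next
    assume "h x \<in> {c' w<..<d' w}"
    then obtain z where z: "c w < z" "z < d w" "f z = h x" using g_onto[of w "h x"] by auto
    then have "z \<in> D" by (auto simp: D_def)
    then have "h z = h x" "z \<in> {L []..R []}" using h(3) z D by auto
    then have "z = x" using inj x by (auto dest: inj_onD)
    then show "x \<in> {c w<..<d w}" using z by auto
  qed
  then show ?thesis
    using that strict_mono_on_interval_continuous[OF h(1,2) le(1)] inj h(2) by blast
qed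

section \<open>The model set as an interval tree\<close>

text \<open>The rule \<open>s\<close> turns a depth and a block into the gap to be removed; the
  depth is passed on so that a rule can depend on its parity.\<close>

fun block :: "(nat \<Rightarrow> real \<times> real \<Rightarrow> real \<times> real) \<Rightarrow> real \<times> real \<Rightarrow> bool list \<Rightarrow> real \<times> real" where
  "block s I [] = I"
| "block s I (e # w) =
    (let J = block s I w; G = s (length w) J in if e then (snd G, snd J) else (fst J, fst G))"

definition block_gap :: "(nat \<Rightarrow> real \<times> real \<Rightarrow> real \<times> real) \<Rightarrow> real \<times> real \<Rightarrow> bool list \<Rightarrow> real \<times> real" where
  "block_gap s I w = s (length w) (block s I w)"

lemma block_invariant:
  assumes "P I" "\<And>n J. P J \<Longrightarrow> P (fst J, fst (s n J)) \<and> P (snd (s n J), snd J)"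
  shows "P (block s I w)"
  using assms by (induction w) (auto simp: Let_def)

lemma interval_tree_block:
  assumes "P I" "\<And>n J. P J \<Longrightarrow> P (fst J, fst (s n J)) \<and> P (snd (s n J), snd J)"
    and "\<And>n J. P J \<Longrightarrow> fst J < fst (s n J) \<and> fst (s n J) < snd (s n J) \<and> snd (s n J) < snd J"
  shows "interval_tree (fst \<circ> block s I) (fst \<circ> block_gap s I) (snd \<circ> block_gap s I) (snd \<circ> block s I)"
  using block_invariant[of P I s, OF assms(1,2)] assms(3)
  by unfold_locales (auto simp: block_gap_def Let_def)

definition middle_third :: "nat \<Rightarrow> real \<times> real \<Rightarrow> real \<times> real" where
  "middle_third n J = (fst J + (snd J - fst J) / 3, snd J - (snd J - fst J) / 3)"

lemma cantor_intervals_eq: "cantor_intervals n = block middle_third (0, 1) ` {w. length w = n}"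
proof (induction n)
  case (Suc n)
  have "{w. length w = Suc n} = (\<Union>w\<in>{w. length w = n}. {False # w, True # w})"
    by (auto simp: length_Suc_conv)
  moreover have "cantor_intervals (Suc n) =
      (\<Union>J\<in>cantor_intervals n. {(fst J, fst (middle_third n J)), (snd (middle_third n J), snd J)})"
    by (simp add: middle_third_def split_beta)
  moreover have "\<dots> = (\<Union>w\<in>{w. length w = n}.
      {block middle_third (0, 1) (False # w), block middle_third (0, 1) (True # w)})"
    unfolding Suc.IH by (simp add: Let_def middle_third_def)
  ultimately show ?case
    by (simp only: image_UN image_insert image_empty)
qed simp

lemma block_middle_third_length:
  "snd (block middle_third (0, 1) w) - fst (block middle_third (0, 1) w) = (1/3) ^ length w"
proof (induction w)
  case (Cons e w)
  then show ?case by (cases e) (simp_all add: Let_def middle_third_def)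
qed simp

abbreviation "cantor_tree_L \<equiv> fst \<circ> block middle_third (0, 1)"
abbreviation "cantor_tree_c \<equiv> fst \<circ> block_gap middle_third (0, 1)"
abbreviation "cantor_tree_d \<equiv> snd \<circ> block_gap middle_third (0, 1)"
abbreviation "cantor_tree_R \<equiv> snd \<circ> block middle_third (0, 1)"

interpretation cantor: interval_tree cantor_tree_L cantor_tree_c cantor_tree_d cantor_tree_R
  by (rule interval_tree_block[where P = "\<lambda>J. fst J < snd J"]) (auto simp: middle_third_def field_simps)

interpretation cantor: dense_interval_tree cantor_tree_L cantor_tree_c cantor_tree_d cantor_tree_R
proof
  fix x y assume xy: "cantor_tree_L [] \<le> x" "x < y" "y \<le> cantor_tree_R []"
  show "\<exists>w. cantor_tree_c w < y \<and> x < cantor_tree_d w"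
  proof (rule ccontr)
    assume "\<nexists>w. cantor_tree_c w < y \<and> x < cantor_tree_d w"
    then have gap: "y \<le> cantor_tree_c w \<or> cantor_tree_d w \<le> x" for w
      by (meson not_le)
    obtain n where n: "(1/3) ^ n < y - x"
      using real_arch_pow_inv[of "y - x" "1/3"] xy by auto
    obtain w where "length w = n" "cantor_tree_L w \<le> x" "y \<le> cantor_tree_R w"
      using cantor.block_avoiding_gaps[OF xy(1) less_imp_le[OF xy(2)] xy(3) gap] by blast
    then show False using n block_middle_third_length[of w] by auto
  qed
qed

lemma cantor_set_eq:
  "cantor_set = {0..1} - (\<Union>w. {cantor_tree_c w<..<cantor_tree_d w})" (is "_ = ?A")
proof -
  have "x \<in> cantor_set \<longleftrightarrow> (\<forall>n. \<exists>w. length w = n \<and> cantor_tree_L w \<le> x \<and> x \<le> cantor_tree_R w)" for x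
    by (auto simp: cantor_set_def cantor_intervals_eq split_beta)
  moreover have "x \<in> ?A" if *: "\<forall>n. \<exists>w. length w = n \<and> cantor_tree_L w \<le> x \<and> x \<le> cantor_tree_R w" for x
  proof -
    have "x \<in> {0..1}" using *[rule_format, of 0] by auto
    moreover have False if w: "cantor_tree_c w < x" "x < cantor_tree_d w" for w
    proof -
      \<comment> \<open>One level below \<open>w\<close> every block avoids the gap of
        \<open>w\<close>: the word \<open>v\<close> is too long to be a suffix of
        \<open>w\<close>.\<close>
      obtain v where "length v = Suc (length w)" "cantor_tree_L v \<le> x" "x \<le> cantor_tree_R v"
        using * by blast
      then show False using cantor.gap_meets_block[OF w, of v] by auto
    qed
    ultimately show ?thesis by auto
  qed
  moreover have "\<exists>w. length w = n \<and> cantor_tree_L w \<le> x \<and> x \<le> cantor_tree_R w" if "x \<in> ?A" for x n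
    using that by (intro cantor.block_avoiding_gap_point) auto
  ultimately show ?thesis by blast
qed

lemma cantor_gaps_eq:
  "cantor_gaps (Suc n) = (\<Union>w\<in>{w. length w = n}. {cantor_tree_c w<..<cantor_tree_d w})"
  by (simp add: cantor_gaps_def cantor_intervals_eq block_gap_def middle_third_def split_beta)

text \<open>Step \<open>n + 1\<close> removes the gaps of the words of length \<open>n\<close>.
  Putting back the gaps of the odd steps therefore fills the gaps at even depth, and exactly those
  at odd depth stay removed.\<close>

lemma cantorval_model_eq:
  "cantor_set \<union> (\<Union>n\<in>{1..}. cantor_gaps (2 * n - 1)) =
    {0..1} - (\<Union>w\<in>{w. odd (length w)}. {cantor_tree_c w<..<cantor_tree_d w})" (is "?l = ?r")
proof -
  have *: "(\<Union>n\<in>{1..}. cantor_gaps (2 * n - 1)) =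
      (\<Union>w\<in>{w. even (length w)}. {cantor_tree_c w<..<cantor_tree_d w})" (is "?U = ?V")
  proof -
    have "{1..} = range Suc" by (auto simp: image_iff Suc_le_eq gr0_conv_Suc)
    then have "?U = (\<Union>n. cantor_gaps (Suc (2 * n)))" by (simp add: image_image)
    also have "\<dots> = ?V"
    proof -
      have "{w :: bool list. even (length w)} = (\<Union>n. {w. length w = 2 * n})"
        by (auto elim: evenE)
      then show ?thesis by (simp add: cantor_gaps_eq)
    qed
    finally show ?thesis .
  qed
  have sub: "x \<in> {0..1}" if "cantor_tree_c w < x" "x < cantor_tree_d w" for x w
    using that cantor.less[of w] cantor.subtree(1)[of "[]" w] cantor.subtree(2)[of w "[]"] by auto
  have disj: "\<not> (cantor_tree_c v < x \<and> x < cantor_tree_d v)"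
    if "cantor_tree_c w < x" "x < cantor_tree_d w" "even (length w)" "odd (length v)" for x w v
    using cantor.gaps_disjoint[of w x v] that by auto
  show ?thesis
  proof (intro set_eqI iffI)
    fix x assume "x \<in> ?l"
    then consider "x \<in> cantor_set" | w where "even (length w)" "cantor_tree_c w < x" "x < cantor_tree_d w"
      unfolding * by auto
    then show "x \<in> ?r"
    proof cases
      case 1
      then show ?thesis by (auto simp: cantor_set_eq)
    next
      case 2
      then show ?thesis using sub[of w x] disj[of w x] by auto
    qed
  next
    fix x assume x: "x \<in> ?r"
    show "x \<in> ?l"
    proof (cases "x \<in> cantor_set")
      case False
      then obtain w where "cantor_tree_c w < x" "x < cantor_tree_d w"
        using x by (auto simp: cantor_set_eq)
      moreover from this have "even (length w)" using x by auto
      ultimately show ?thesis unfolding * by auto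
    qed simp
  qed
qed

text \<open>The homeomorphism of the hulls preserves words, hence also the parity of their lengths,
  so it carries \<open>X\<close> onto the model set; compactness gives continuity of the
  inverse.\<close>

lemma cantorval_if_interval_tree:
  assumes tree: "dense_interval_tree L c d R" and X: "compact X"
    and eq: "X = {L []..R []} - (\<Union>w\<in>{w. odd (length w)}. {c w<..<d w})"
  shows "cantorval X"
proof -
  obtain h where h: "continuous_on {L []..R []} h" "inj_on h {L []..R []}" "h ` {L []..R []} = {0..1}"
    "\<And>w x. x \<in> {L []..R []} \<Longrightarrow>
        h x \<in> {cantor_tree_c w<..<cantor_tree_d w} \<longleftrightarrow> x \<in> {c w<..<d w}"
    using dense_interval_trees_homeomorphism[OF tree cantor.dense_interval_tree_axioms] by auto
  have "h ` X = {0..1} - (\<Union>w\<in>{w. odd (length w)}. {cantor_tree_c w<..<cantor_tree_d w})"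
    unfolding eq h(3)[symmetric] using h(4) by blast
  moreover have "X \<subseteq> {L []..R []}" using eq by auto
  ultimately show ?thesis
    unfolding cantorval_def cantorval_model_eq
    using X h(1,2) by (intro homeomorphic_compact[of X h]) (auto intro: continuous_on_subset inj_on_subset)
qed

section \<open>A criterion for Cantorvals\<close>

text \<open>The ends are the last point outside \<open>S\<close> to the left of \<open>x\<close> and
  the first one to the right, which exist by compactness.\<close>

lemma open_component_interval:
  fixes S :: "real set"
  assumes "open S" "x \<in> S" "a < x" "x < b" "a \<notin> S" "b \<notin> S"
  obtains c d where "a \<le> c" "c < x" "x < d" "d \<le> b" "{c<..<d} \<subseteq> S" "c \<notin> S" "d \<notin> S"
proof -
  have "compact ({a..x} - S)" "compact ({x..b} - S)"
    using assms(1) by (auto intro: compact_diff)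
  moreover have "{a..x} - S \<noteq> {}" "{x..b} - S \<noteq> {}"
    using assms by (auto simp: subset_iff intro: exI[of _ a] exI[of _ b])
  ultimately obtain c d where c: "c \<in> {a..x} - S" "\<And>y. y \<in> {a..x} - S \<Longrightarrow> y \<le> c"
    and d: "d \<in> {x..b} - S" "\<And>y. y \<in> {x..b} - S \<Longrightarrow> d \<le> y"
    by (metis compact_attains_sup compact_attains_inf)
  have "c \<noteq> x" "d \<noteq> x" using c(1) d(1) assms(2) by auto
  moreover have "y \<in> S" if "c < y" "y < d" for y
    using c(2)[of y] d(2)[of y] that c(1) d(1) by (cases "y \<le> x") force+
  ultimately show ?thesis using c(1) d(1) by (intro that[of c d]) auto
qed

text \<open>For open \<open>S\<close>, a connected component of \<open>S\<close> whose closure lies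
  in the open block, so that both remaining blocks have positive length.\<close>

definition component_in :: "real set \<Rightarrow> real \<times> real \<Rightarrow> real \<times> real \<Rightarrow> bool" where
  "component_in S J G \<longleftrightarrow> fst J < fst G \<and> fst G < snd G \<and> snd G < snd J \<and>
     {fst G<..<snd G} \<subseteq> S \<and> fst G \<notin> S \<and> snd G \<notin> S"

text \<open>With the factor 2 such a component exists as soon as there is any component: take one
  longer than half the supremum of the lengths.\<close>

definition large_component :: "real set \<Rightarrow> real \<times> real \<Rightarrow> real \<times> real" where
  "large_component S J = (SOME G. component_in S J G \<and>
     (\<forall>G'. component_in S J G' \<longrightarrow> snd G' - fst G' \<le> 2 * (snd G - fst G)))"

lemma large_component:
  assumes "component_in S J G0"
  shows "component_in S J (large_component S J)"
    and "component_in S J G \<Longrightarrow>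
      snd G - fst G \<le> 2 * (snd (large_component S J) - fst (large_component S J))"
proof -
  define Z where "Z = {snd G - fst G | G. component_in S J G}"
  have bdd: "bdd_above Z"
    by (rule bdd_aboveI[of _ "snd J - fst J"]) (auto simp: Z_def component_in_def)
  have "snd G0 - fst G0 \<in> Z" "snd G0 - fst G0 > 0"
    using assms by (auto simp: Z_def component_in_def)
  then have "Sup Z / 2 < Sup Z"
    using cSup_upper[OF _ bdd, of "snd G0 - fst G0"] by auto
  then obtain z where "z \<in> Z" "Sup Z / 2 < z"
    using less_cSup_iff[of Z "Sup Z / 2"] bdd \<open>snd G0 - fst G0 \<in> Z\<close> by auto
  then obtain G1 where "component_in S J G1" "Sup Z / 2 < snd G1 - fst G1"
    by (auto simp: Z_def)
  moreover have "snd G - fst G \<le> Sup Z" if "component_in S J G" for G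
    using that by (intro cSup_upper[OF _ bdd]) (unfold Z_def, blast)
  ultimately have "\<exists>G. component_in S J G \<and>
     (\<forall>G'. component_in S J G' \<longrightarrow> snd G' - fst G' \<le> 2 * (snd G - fst G))"
    by (intro exI[of _ G1]) fastforce
  from someI_ex[OF this]
  show "component_in S J (large_component S J)"
    and "component_in S J G \<Longrightarrow>
      snd G - fst G \<le> 2 * (snd (large_component S J) - fst (large_component S J))"
    by (auto simp: large_component_def)
qed

lemma closure_real_approach:
  fixes x :: real
  assumes "x \<in> closure S" "e > 0"
  obtains y where "y \<in> S" "\<bar>y - x\<bar> < e"
  using assms closure_approachable[of x S] by (auto simp: dist_real_def)

locale cantorval_like =
  fixes X :: "real set"
  assumes compact: "compact X" and nonempty: "X \<noteq> {}"
    and regular: "X = closure (interior X)"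
    and no_half_line: "\<And>p e. p \<in> X \<Longrightarrow> e > 0 \<Longrightarrow>
        \<not> ({p - e<..<p} \<inter> X = {} \<and> {p<..<p + e} \<subseteq> X)"
      "\<And>p e. p \<in> X \<Longrightarrow> e > 0 \<Longrightarrow>
        \<not> ({p - e<..<p} \<subseteq> X \<and> {p<..<p + e} \<inter> X = {})"
begin

section \<open>Intervals, gaps and their common boundary\<close>

text \<open>The components of \<open>phase True\<close> and \<open>phase False\<close> are the intervals of \<open>X\<close> and the gaps
  of \<open>X\<close>; all arguments are symmetric in the two.\<close>

definition phase :: "bool \<Rightarrow> real set" where
  "phase i = (if i then interior X else - X)"

text \<open>The topological boundary of \<open>X\<close>, as \<open>X\<close> is closed.\<close>

definition F :: "real set" where
  "F = X - interior X"

lemma closed: "closed X"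
  using compact by (rule compact_imp_closed)

lemma open_phase: "open (phase i)"
  using closed by (auto simp: phase_def)

lemma phase_disjoint: "x \<in> phase i \<Longrightarrow> x \<notin> phase (\<not> i)"
  using interior_subset[of X] by (cases i) (auto simp: phase_def)

lemma phase_F_cases: "x \<in> F \<or> x \<in> phase i \<or> x \<in> phase (\<not> i)"
  by (cases i) (auto simp: F_def phase_def)

lemma F_not_phase: "x \<in> F \<Longrightarrow> x \<notin> phase i"
  by (cases i) (auto simp: F_def phase_def)

text \<open>For the interior this is regularity of \<open>X\<close>; for the complement, a point of
  \<open>F\<close> is not interior to \<open>X\<close>.\<close>

lemma F_approach:
  assumes "x \<in> F" "e > 0"
  obtains y where "y \<in> phase i" "\<bar>y - x\<bar> < e"
proof -
  have "x \<in> closure (phase i)"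
    using assms regular by (auto simp: phase_def F_def closure_complement)
  then show ?thesis using that assms closure_real_approach by blast
qed

lemma F_one_sided:
  assumes "p \<in> F" "e > 0"
  shows "\<not> ({p - e<..<p} \<subseteq> phase i \<and> {p<..<p + e} \<subseteq> phase (\<not> i))"
  using no_half_line[of p e] assms interior_subset[of X] by (cases i) (auto simp: phase_def F_def)

text \<open>Points fit to be the left end of a block: both phases accumulate from inside, so the
  block contains components of either phase away from its ends.\<close>

definition left_end :: "real \<Rightarrow> bool" where
  "left_end u \<longleftrightarrow> u \<in> F \<and> (\<forall>e>0. \<forall>i. \<exists>y\<in>phase i. u < y \<and> y < u + e)"

definition right_end :: "real \<Rightarrow> bool" where
  "right_end u \<longleftrightarrow> u \<in> F \<and> (\<forall>e>0. \<forall>i. \<exists>y\<in>phase i. u - e < y \<and> y < u)"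

text \<open>Phase \<open>i\<close> fills the right side of \<open>p\<close>, so the opposite phase
  can accumulate only from the left. Phase \<open>i\<close> accumulates there too, since otherwise
  the left side would belong to the opposite phase near \<open>p\<close>, a local half-line.\<close>

lemma right_endI:
  assumes "p \<in> F" "e > 0" "{p<..<p + e} \<subseteq> phase i"
  shows "right_end p"
proof -
  have "\<exists>y\<in>phase j. p - r < y \<and> y < p" if r: "r > 0" for j r
  proof (cases "i = j")
    case False
    then have j: "j = (\<not> i)" by auto
    obtain y where y: "y \<in> phase j" "\<bar>y - p\<bar> < min e r"
      using F_approach[OF assms(1), of "min e r"] assms(2) r by auto
    moreover have "\<not> p < y"
      using phase_disjoint[of y i] y assms(3) j by (auto simp: subset_iff)
    moreover have "y \<noteq> p" using F_not_phase assms(1) y by auto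
    ultimately show ?thesis by (intro bexI[of _ y]) auto
  next
    case True
    have "{p<..<p + min e r} \<subseteq> {p<..<p + e}" by auto
    then have "{p<..<p + min e r} \<subseteq> phase i" using assms(3) by (rule subset_trans)
    then have "\<not> {p - min e r<..<p} \<subseteq> phase (\<not> i)"
      using F_one_sided[OF assms(1), of "min e r" "\<not> i"] assms(2) r by auto
    then obtain x where x: "p - min e r < x" "x < p" "x \<notin> phase (\<not> i)"
      by (meson subsetI greaterThanLessThan_iff)
    from x(1) have "p - r < x" by linarith
    consider "x \<in> phase i" | "x \<in> F" using x phase_F_cases[of x i] by auto
    then show ?thesis
    proof cases
      case 1
      then show ?thesis using x(2) \<open>p - r < x\<close> True by blast
    next
      case 2
      then obtain y where "y \<in> phase i" "\<bar>y - x\<bar> < min (p - x) (x - (p - r))"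
        using F_approach[of x "min (p - x) (x - (p - r))"] x(2) \<open>p - r < x\<close> by auto
      then show ?thesis using True by (intro bexI[of _ y]) auto
    qed
  qed
  then show ?thesis using assms by (auto simp: right_end_def)
qed

lemma left_endI:
  assumes "p \<in> F" "e > 0" "{p - e<..<p} \<subseteq> phase i"
  shows "left_end p"
proof -
  have "\<exists>y\<in>phase j. p < y \<and> y < p + r" if r: "r > 0" for j r
  proof (cases "i = j")
    case False
    then have j: "j = (\<not> i)" by auto
    obtain y where y: "y \<in> phase j" "\<bar>y - p\<bar> < min e r"
      using F_approach[OF assms(1), of "min e r"] assms(2) r by auto
    moreover have "\<not> y < p"
      using phase_disjoint[of y i] y assms(3) j by (auto simp: subset_iff)
    moreover have "y \<noteq> p" using F_not_phase assms(1) y by auto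
    ultimately show ?thesis by (intro bexI[of _ y]) auto
  next
    case True
    have "{p - min e r<..<p} \<subseteq> {p - e<..<p}" by auto
    then have "{p - min e r<..<p} \<subseteq> phase i" using assms(3) by (rule subset_trans)
    then have "\<not> {p<..<p + min e r} \<subseteq> phase (\<not> i)"
      using F_one_sided[OF assms(1), of "min e r" i] assms(2) r by auto
    then obtain x where x: "p < x" "x < p + min e r" "x \<notin> phase (\<not> i)"
      by (meson subsetI greaterThanLessThan_iff)
    from x(2) have "x < p + r" by linarith
    consider "x \<in> phase i" | "x \<in> F" using x phase_F_cases[of x i] by auto
    then show ?thesis
    proof cases
      case 1
      then show ?thesis using x(1) \<open>x < p + r\<close> True by blast
    next
      case 2
      then obtain y where "y \<in> phase i" "\<bar>y - x\<bar> < min (x - p) (p + r - x)"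
        using F_approach[of x "min (x - p) (p + r - x)"] x(1) \<open>x < p + r\<close> by auto
      then show ?thesis using True by (intro bexI[of _ y]) auto
    qed
  qed
  then show ?thesis using assms by (auto simp: left_end_def)
qed

lemma limit_in_F:
  assumes "p \<notin> phase i" "\<And>e. e > 0 \<Longrightarrow> \<exists>y\<in>phase i. \<bar>y - p\<bar> < e"
  shows "p \<in> F"
proof (rule ccontr)
  assume "p \<notin> F"
  then have "p \<in> phase (\<not> i)" using phase_F_cases[of p i] assms(1) by auto
  then obtain e where "e > 0" "ball p e \<subseteq> phase (\<not> i)"
    using open_phase open_contains_ball by blast
  moreover from this obtain y where "y \<in> phase i" "\<bar>y - p\<bar> < e" using assms(2) by blast
  ultimately show False using phase_disjoint[of y i] by (auto simp: dist_real_def subset_iff)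
qed

text \<open>The names refer to the blocks that remain: the left end of a removed component closes
  the block to its left.\<close>

lemma component_ends:
  assumes "component_in (phase i) J G"
  shows "right_end (fst G)" "left_end (snd G)"
proof -
  obtain c d where G: "G = (c, d)" by (cases G)
  have cd: "c < d" "{c<..<d} \<subseteq> phase i" "c \<notin> phase i" "d \<notin> phase i"
    using assms by (auto simp: component_in_def G)
  have "c \<in> F"
  proof (rule limit_in_F[OF cd(3)])
    fix e :: real assume "e > 0"
    then obtain y where "c < y" "y < min d (c + e)" using dense[of c "min d (c + e)"] cd by auto
    then show "\<exists>y\<in>phase i. \<bar>y - c\<bar> < e" using cd(2) by (intro bexI[of _ y]) auto
  qed
  then show "right_end (fst G)" using right_endI[of c "d - c" i] cd by (simp add: G)
  have "d \<in> F"
  proof (rule limit_in_F[OF cd(4)])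
    fix e :: real assume "e > 0"
    then obtain y where "max c (d - e) < y" "y < d" using dense[of "max c (d - e)" d] cd by auto
    then show "\<exists>y\<in>phase i. \<bar>y - d\<bar> < e" using cd(2) by (intro bexI[of _ y]) auto
  qed
  then show "left_end (snd G)" using left_endI[of d "d - c" i] cd by (simp add: G)
qed

section \<open>Cutting blocks alternately in the two phases\<close>

definition good_block :: "real \<times> real \<Rightarrow> bool" where
  "good_block J \<longleftrightarrow> left_end (fst J) \<and> right_end (snd J) \<and> fst J < snd J"

text \<open>Near both ends of the block there are points of the opposite phase, and they confine the
  component of \<open>x\<close> strictly inside.\<close>

lemma good_block_component:
  assumes "good_block J" "x \<in> phase i" "fst J < x" "x < snd J"
  obtains G where "component_in (phase i) J G" "fst G < x" "x < snd G"
proof -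
  obtain a where a: "a \<in> phase (\<not> i)" "fst J < a" "a < x"
    using assms(1,3) unfolding good_block_def left_end_def
    by (metis add.commute diff_add_cancel diff_gt_0_iff_gt)
  obtain b where b: "b \<in> phase (\<not> i)" "x < b" "b < snd J"
    using assms(1,4) unfolding good_block_def right_end_def
    by (metis diff_diff_eq2 diff_gt_0_iff_gt add_diff_cancel_left')
  have "a \<notin> phase i" "b \<notin> phase i" using a b phase_disjoint by blast+
  then obtain c d where "a \<le> c" "c < x" "x < d" "d \<le> b" "{c<..<d} \<subseteq> phase i" "c \<notin> phase i" "d \<notin> phase i"
    using open_component_interval[OF open_phase assms(2) a(3) b(2)] by blast
  then show ?thesis using a b by (intro that[of "(c, d)"]) (auto simp: component_in_def)
qed

lemma good_block_component_exists:
  assumes "good_block J"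
  shows "\<exists>G. component_in (phase i) J G"
proof -
  obtain x where "x \<in> phase i" "fst J < x" "x < snd J"
    using assms unfolding good_block_def left_end_def
    by (metis add.commute diff_add_cancel diff_gt_0_iff_gt)
  then show ?thesis using good_block_component assms by blast
qed

text \<open>Even depths remove intervals of \<open>X\<close> and odd depths remove gaps of
  \<open>X\<close>, the parity found in \<open>cantorval_model_eq\<close>.\<close>

definition pick :: "nat \<Rightarrow> real \<times> real \<Rightarrow> real \<times> real" where
  "pick n J = large_component (phase (even n)) J"

lemma pick_component:
  "good_block J \<Longrightarrow> component_in (phase (even n)) J (pick n J)"
  unfolding pick_def using good_block_component_exists large_component(1) by blast

lemma pick_good:
  assumes "good_block J"
  shows "good_block (fst J, fst (pick n J))" "good_block (snd (pick n J), snd J)"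
  using pick_component[OF assms, of n] component_ends[OF pick_component[OF assms, of n]] assms
  by (auto simp: good_block_def component_in_def)

definition hull_ends :: "real \<times> real" where
  "hull_ends = (Inf X, Sup X)"

lemma bounds: "x \<in> X \<Longrightarrow> Inf X \<le> x" "x \<in> X \<Longrightarrow> x \<le> Sup X" "Inf X \<in> X" "Sup X \<in> X"
  using compact nonempty closed compact_imp_bounded[OF compact]
  by (auto intro: cInf_lower cSup_upper closed_contains_Inf closed_contains_Sup
      bounded_imp_bdd_below bounded_imp_bdd_above)

text \<open>Outside the hull there is only complement, so its ends behave like ends of gaps.\<close>

lemma good_hull: "good_block hull_ends"
proof -
  have gap: "{Inf X - 1<..<Inf X} \<subseteq> phase False" "{Sup X<..<Sup X + 1} \<subseteq> phase False"
    using bounds by (fastforce simp: phase_def)+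
  have "Inf X \<in> F"
  proof (rule limit_in_F[of _ False])
    fix e :: real assume "e > 0"
    then show "\<exists>y\<in>phase False. \<bar>y - Inf X\<bar> < e"
      using bounds(1)[of "Inf X - e / 2"]
      by (intro bexI[of _ "Inf X - e / 2"]) (auto simp: phase_def)
  qed (use bounds in \<open>auto simp: phase_def\<close>)
  then have l: "left_end (Inf X)" using gap by (intro left_endI[of _ 1]) auto
  have "Sup X \<in> F"
  proof (rule limit_in_F[of _ False])
    fix e :: real assume "e > 0"
    then show "\<exists>y\<in>phase False. \<bar>y - Sup X\<bar> < e"
      using bounds(2)[of "Sup X + e / 2"]
      by (intro bexI[of _ "Sup X + e / 2"]) (auto simp: phase_def)
  qed (use bounds in \<open>auto simp: phase_def\<close>)
  then have r: "right_end (Sup X)" using gap by (intro right_endI[of _ 1]) auto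
  obtain y where "y \<in> phase True" "Inf X < y"
    using l unfolding left_end_def by (metis zero_less_one)
  then have "Inf X < Sup X"
    using bounds(2)[of y] interior_subset[of X] by (auto simp: phase_def)
  then show ?thesis using l r by (simp add: good_block_def hull_ends_def)
qed

abbreviation "tree_L \<equiv> fst \<circ> block pick hull_ends"
abbreviation "tree_c \<equiv> fst \<circ> block_gap pick hull_ends"
abbreviation "tree_d \<equiv> snd \<circ> block_gap pick hull_ends"
abbreviation "tree_R \<equiv> snd \<circ> block pick hull_ends"

lemma good_block_tree: "good_block (block pick hull_ends w)"
  by (rule block_invariant) (auto simp: good_hull pick_good)

sublocale tree: interval_tree tree_L tree_c tree_d tree_R
proof (rule interval_tree_block[where P = good_block])
  fix n J assume "good_block J"
  then show "fst J < fst (pick n J) \<and> fst (pick n J) < snd (pick n J) \<and> snd (pick n J) < snd J"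
    using pick_component by (auto simp: component_in_def)
qed (auto simp: good_hull pick_good)

lemma block_gap_component:
  "component_in (phase (even (length w))) (block pick hull_ends w) (block_gap pick hull_ends w)"
  unfolding block_gap_def by (rule pick_component[OF good_block_tree])

lemma phase_dense:
  assumes "x < y"
  obtains z i where "z \<in> phase i" "x < z" "z < y"
proof -
  obtain z where z: "x < z" "z < y" using dense assms by blast
  show ?thesis
  proof (cases "z \<in> F")
    case True
    then obtain v where "v \<in> phase True" "\<bar>v - z\<bar> < min (z - x) (y - z)"
      using F_approach[of z "min (z - x) (y - z)"] z by auto
    then show ?thesis by (intro that[of v True]) auto
  next
    case False
    then show ?thesis using phase_F_cases[of z True] z that by blast
  qed
qed

text \<open>Blocks of matching parity that contain a point of a component of \<open>phase i\<close> keep losing a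
  fixed length, because this component competes at every such step and never gets selected.\<close>

lemma pick_loses_length:
  assumes "ball z r \<subseteq> phase i" "r > 0" "i = even (length w)" "tree_L w < z" "z < tree_R w"
  shows "r \<le> tree_d w - tree_c w"
proof -
  have "z \<in> phase i" using assms by auto
  then obtain G where G: "component_in (phase i) (block pick hull_ends w) G" "fst G < z" "z < snd G"
    using good_block_component[OF good_block_tree, of z i w] assms by auto
  have "r \<le> z - fst G" "r \<le> snd G - z"
  proof -
    have "fst G \<notin> ball z r" "snd G \<notin> ball z r"
      using G assms(1) by (auto simp: component_in_def)
    then show "r \<le> z - fst G" "r \<le> snd G - z" using G by (auto simp: dist_real_def)
  qed
  \<comment> \<open>The component around \<open>z\<close> has length at least \<open>2 * r\<close>,
    which absorbs the factor 2 in the choice of \<open>large_component\<close>.\<close>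
  moreover have "snd G - fst G \<le> 2 * (tree_d w - tree_c w)"
    using large_component(2)[OF G(1) G(1)] assms(3) by (simp add: block_gap_def pick_def)
  ultimately show ?thesis by simp
qed

text \<open>Otherwise a point \<open>z\<close> of some phase between \<open>x\<close> and
  \<open>y\<close> stays inside one block at every depth. By \<open>pick_loses_length\<close> these
  blocks lose at least \<open>r\<close> at every second depth, so their lengths would become
  negative.\<close>

lemma tree_dense:
  assumes xy: "tree_L [] \<le> x" "x < y" "y \<le> tree_R []"
  shows "\<exists>w. tree_c w < y \<and> x < tree_d w"
proof (rule ccontr)
  assume "\<nexists>w. tree_c w < y \<and> x < tree_d w"
  then have gap: "y \<le> tree_c w \<or> tree_d w \<le> x" for w by (meson not_le)
  obtain z i where z: "z \<in> phase i" "x < z" "z < y" using phase_dense xy(2) by blast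
  then obtain r where r: "r > 0" "ball z r \<subseteq> phase i"
    using open_phase open_contains_ball by blast
  have child: "\<exists>e. tree_L (e # w) \<le> x \<and> y \<le> tree_R (e # w) \<and>
      tree_R (e # w) - tree_L (e # w) \<le> tree_R w - tree_L w - (tree_d w - tree_c w)"
    if "tree_L w \<le> x" "y \<le> tree_R w" for w
  proof (cases "y \<le> tree_c w")
    case True
    then show ?thesis using that tree.less[of w] by (intro exI[of _ False]) (auto simp: tree.left simp del: o_apply)
  next
    case False
    then show ?thesis using that gap[of w] tree.less[of w]
      by (intro exI[of _ True]) (auto simp: tree.right simp del: o_apply)
  qed
  \<comment> \<open>Two levels at a time: exactly one of them has the parity of the phase
    \<open>i\<close>.\<close>
  have "\<exists>w. length w = 2 * k \<and> tree_L w \<le> x \<and> y \<le> tree_R w \<and>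
      tree_R w - tree_L w \<le> tree_R [] - tree_L [] - real k * r" for k
  proof (induction k)
    case (Suc k)
    then obtain w where w: "length w = 2 * k" "tree_L w \<le> x" "y \<le> tree_R w"
        "tree_R w - tree_L w \<le> tree_R [] - tree_L [] - real k * r"
      by blast
    obtain e where e: "tree_L (e # w) \<le> x" "y \<le> tree_R (e # w)"
        "tree_R (e # w) - tree_L (e # w) \<le> tree_R w - tree_L w - (tree_d w - tree_c w)"
      using child[OF w(2,3)] by blast
    obtain e' where e': "tree_L (e' # e # w) \<le> x" "y \<le> tree_R (e' # e # w)"
        "tree_R (e' # e # w) - tree_L (e' # e # w) \<le>
          tree_R (e # w) - tree_L (e # w) - (tree_d (e # w) - tree_c (e # w))"
      using child[OF e(1,2)] by blast
    have "r \<le> (tree_d w - tree_c w) + (tree_d (e # w) - tree_c (e # w))"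
    proof (cases i)
      case True
      then have "r \<le> tree_d w - tree_c w"
        using pick_loses_length[OF r(2,1), of w] w z by (auto simp del: o_apply)
      then show ?thesis using tree.less[of "e # w"] by linarith
    next
      case False
      then have "r \<le> tree_d (e # w) - tree_c (e # w)"
        using pick_loses_length[OF r(2,1), of "e # w"] w e z by (auto simp del: o_apply)
      then show ?thesis using tree.less[of w] by linarith
    qed
    then have "tree_R (e' # e # w) - tree_L (e' # e # w) \<le> tree_R [] - tree_L [] - real (Suc k) * r"
      using e(3) e'(3) w(4) by (simp add: algebra_simps del: o_apply)
    then show ?case using e' w(1) by (intro exI[of _ "e' # e # w"]) (simp del: o_apply)
  qed (use xy in \<open>auto simp del: o_apply\<close>)
  moreover obtain k where "tree_R [] - tree_L [] < real k * r"
    using reals_Archimedean3[OF r(1)] by blast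
  ultimately obtain w where "tree_R w - tree_L w < 0" by (smt (verit))
  then show False using tree.less[of w] by linarith
qed

sublocale tree: dense_interval_tree tree_L tree_c tree_d tree_R
  using tree_dense by unfold_locales

text \<open>For the inclusion from right to left, a ball around a point of the complement meets some
  gap of the tree by density. That gap then lies in the complement, so its depth is odd; its ends
  belong to \<open>X\<close>, hence lie outside the ball, and the gap covers the centre.\<close>

lemma X_eq_tree:
  "X = {tree_L []..tree_R []} - (\<Union>w\<in>{w. odd (length w)}. {tree_c w<..<tree_d w})" (is "_ = ?r")
proof (intro set_eqI iffI)
  fix x assume x: "x \<in> X"
  have "\<not> (tree_c w < x \<and> x < tree_d w)" if "odd (length w)" for w
    using block_gap_component[of w] that x by (auto simp: component_in_def phase_def)
  then show "x \<in> ?r" using bounds(1,2)[OF x] by (auto simp: hull_ends_def)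
next
  fix x assume x: "x \<in> ?r"
  show "x \<in> X"
  proof (rule ccontr)
    assume "x \<notin> X"
    then obtain r where r: "r > 0" "ball x r \<subseteq> phase False"
      using open_phase[of False] open_contains_ball[of "phase False"] by (auto simp: phase_def)
    have x': "tree_L [] < x" "x < tree_R []"
      using x \<open>x \<notin> X\<close> bounds(3,4) by (auto simp: hull_ends_def less_le)
    \<comment> \<open>The ball is clipped to the hull, where density is available.\<close>
    define u v where "u = max (tree_L []) (x - r)" and "v = min (tree_R []) (x + r)"
    have "tree_L [] \<le> u" "v \<le> tree_R []" "u < x" "x < v"
      using x' r(1) by (auto simp: u_def v_def simp del: o_apply)
    then obtain w where w: "tree_c w < v" "u < tree_d w"
      using tree.dense[of u v] by auto
    note G = block_gap_component[of w, unfolded component_in_def]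
    obtain z where z: "max u (tree_c w) < z" "z < min v (tree_d w)"
      using dense[of "max u (tree_c w)" "min v (tree_d w)"] w tree.less[of w] \<open>u < x\<close> \<open>x < v\<close>
      by auto
    then have "z \<in> phase False" using r(2) by (auto simp: u_def v_def dist_real_def subset_iff)
    moreover have "z \<in> phase (even (length w))" using z G by auto
    ultimately have odd: "odd (length w)" using phase_disjoint[of z False] by (cases "even (length w)") auto
    then have "tree_c w \<notin> ball x r" "tree_d w \<notin> ball x r" using G r(2) by auto
    then have "tree_c w < x" "x < tree_d w"
      using w z by (auto simp: u_def v_def dist_real_def abs_less_iff)
    then show False using x odd by auto
  qed
qed

theorem cantorval_X: "cantorval X"
  by (rule cantorval_if_interval_tree[OF tree.dense_interval_tree_axioms compact X_eq_tree])

end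

section \<open>The self-similar set\<close>

definition base :: "nat \<Rightarrow> real" where
  "base l = real (2 * l + 2)"

lemma base_ge: "base l \<ge> 2"
  by (simp add: base_def)

lemma digits_T_le: "t \<in> digits_T l \<Longrightarrow> t \<le> 4 * l + 1"
  by (auto simp: digits_T_def)

lemma zero_in_digits_T: "0 \<in> digits_T l"
  by (simp add: digits_T_def)

lemma finite_digits_T: "finite (digits_T l)"
  by (rule finite_subset[of _ "{..4 * l + 1}"]) (auto dest: digits_T_le)

lemma reflect_digits_T: "t \<in> digits_T l \<Longrightarrow> 4 * l + 1 - t \<in> digits_T l"
  by (auto simp: digits_T_def)

text \<open>Even residues and \<open>2 * l + 1\<close> are digits themselves; any other odd residue
  becomes a digit after adding the base \<open>2 * l + 2\<close>.\<close>

lemma digits_T_residue: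
  fixes z :: int
  obtains t q where "t \<in> digits_T l" "z = int t + int (2 * l + 2) * q"
proof -
  define m where "m = nat (z mod int (2 * l + 2))"
  define q where "q = z div int (2 * l + 2)"
  have z: "z = int m + int (2 * l + 2) * q"
    by (simp add: m_def q_def)
  have m: "m < 2 * l + 2"
    by (simp add: m_def nat_less_iff)
  show ?thesis
  proof (cases "even m \<or> m = 2 * l + 1")
    case True
    then have "m \<in> digits_T l"
      using m by (auto simp: digits_T_def elim!: evenE)
    then show ?thesis using that z by blast
  next
    case False
    then have "m + (2 * l + 2) \<in> digits_T l"
      using m by (auto simp: digits_T_def elim!: oddE)
    moreover have "z = int (m + (2 * l + 2)) + int (2 * l + 2) * (q - 1)"
      by (subst z) (simp add: algebra_simps)
    ultimately show ?thesis using that by blast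
  qed
qed

definition expansion :: "nat \<Rightarrow> (nat \<Rightarrow> nat) \<Rightarrow> real" where
  "expansion l e = (\<Sum>i. real (e (Suc i)) / base l ^ Suc i)"

lemma K_set_iff: "x \<in> K_set l \<longleftrightarrow> (\<exists>e. (\<forall>i\<ge>1. e i \<in> digits_T l) \<and> x = expansion l e)"
  unfolding K_set_def expansion_def base_def by blast

lemma expansion_shift:
  assumes "\<forall>i\<ge>1. e i \<in> digits_T l"
  shows "base l * expansion l e = expansion l (\<lambda>i. e (Suc i)) + real (e (Suc 0))"
proof -
  have b: "base l \<noteq> 0" using base_ge[of l] by linarith
  have e': "\<forall>i\<ge>1. e (Suc i) \<in> digits_T l" using assms by auto
  note sm = summable_K_set[OF assms, folded base_def]
  have "expansion l e = (\<Sum>i. real (e (Suc (Suc i))) / base l ^ Suc (Suc i)) + real (e (Suc 0)) / base l"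
    using suminf_split_head[OF sm] unfolding expansion_def power_Suc0_right power_one_right by linarith
  also have "(\<Sum>i. real (e (Suc (Suc i))) / base l ^ Suc (Suc i)) =
      (\<Sum>i. real (e (Suc (Suc i))) / base l ^ Suc i / base l)"
    by (simp only: power_Suc2 divide_divide_eq_left)
  also have "\<dots> = expansion l (\<lambda>i. e (Suc i)) / base l"
    unfolding expansion_def using summable_K_set[OF e', folded base_def] by (rule suminf_divide)
  finally show ?thesis using b by (simp add: distrib_left)
qed

text \<open>With \<open>K_set_uncons\<close> this is self-similarity: prepending a digit and
  removing the first digit.\<close>

lemma K_set_Cons:
  assumes "t \<in> digits_T l" "x \<in> K_set l"
  shows "(x + real t) / base l \<in> K_set l"
proof -
  obtain e where e: "\<forall>i\<ge>1. e i \<in> digits_T l" "x = expansion l e"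
    using assms(2) unfolding K_set_iff by blast
  define e' where "e' i = (if i = Suc 0 then t else e (i - 1))" for i
  have e': "\<forall>i\<ge>1. e' i \<in> digits_T l" using e(1) assms(1) by (auto simp: e'_def)
  have "expansion l (\<lambda>i. e' (Suc i)) = expansion l e" by (simp add: expansion_def e'_def)
  moreover have "e' (Suc 0) = t" by (simp add: e'_def)
  ultimately have "base l * expansion l e' = x + real t"
    using expansion_shift[OF e'] e(2) by simp
  moreover have "base l \<noteq> 0" using base_ge[of l] by linarith
  ultimately have "(x + real t) / base l = expansion l e'" by (metis nonzero_mult_div_cancel_left)
  then show ?thesis using e' unfolding K_set_iff by blast
qed

lemma K_set_uncons:
  assumes "x \<in> K_set l"
  obtains t where "t \<in> digits_T l" "base l * x - real t \<in> K_set l"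
proof -
  obtain e where e: "\<forall>i\<ge>1. e i \<in> digits_T l" "x = expansion l e"
    using assms unfolding K_set_iff by blast
  have "base l * x - real (e (Suc 0)) = expansion l (\<lambda>i. e (Suc i))"
    using expansion_shift[OF e(1)] unfolding e(2) by linarith
  moreover have "\<forall>i\<ge>1. e (Suc i) \<in> digits_T l" using e(1) by auto
  ultimately have "base l * x - real (e (Suc 0)) \<in> K_set l"
    unfolding K_set_iff by (intro exI[of _ "\<lambda>i. e (Suc i)"] conjI)
  moreover have "e (Suc 0) \<in> digits_T l" using e(1) by simp
  ultimately show ?thesis using that by blast
qed

section \<open>Bounds, compactness and symmetry\<close>

text \<open>The value of the expansion all of whose digits are \<open>4 * l + 1\<close>.\<close>

definition K_top :: "nat \<Rightarrow> real" where
  "K_top l = real (4 * l + 1) / real (2 * l + 1)"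

lemma K_top_bounds: "0 < K_top l" "K_top l < 2"
  by (simp_all add: K_top_def pos_divide_less_eq)

lemma K_set_bounds:
  assumes "x \<in> K_set l"
  shows "0 \<le> x" "x \<le> K_top l"
proof -
  obtain e where e: "\<forall>i\<ge>1. e i \<in> digits_T l" "x = expansion l e"
    using assms unfolding K_set_iff by blast
  note sm = summable_K_set[OF e(1), folded base_def]
  have b: "base l > 1" using base_ge[of l] by simp
  show "0 \<le> x" unfolding e(2) expansion_def using b by (intro suminf_nonneg sm) auto
  have geo: "(\<lambda>i. real (4 * l + 1) / base l * (1 / base l) ^ i) sums
      (real (4 * l + 1) / base l * (1 / (1 - 1 / base l)))"
    using b by (intro sums_mult geometric_sums) auto
  have "x \<le> real (4 * l + 1) / base l * (1 / (1 - 1 / base l))"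
    unfolding e(2) expansion_def
  proof (rule sums_le[OF _ summable_sums[OF sm] geo])
    fix i
    have "real (e (Suc i)) / base l ^ Suc i \<le> real (4 * l + 1) / base l ^ Suc i"
      using b digits_T_le e(1) by (intro divide_right_mono of_nat_mono) auto
    then show "real (e (Suc i)) / base l ^ Suc i \<le> real (4 * l + 1) / base l * (1 / base l) ^ i"
      by (simp add: power_divide)
  qed
  also have "\<dots> = real (4 * l + 1) / (base l - 1)"
    using b by (simp add: field_simps)
  finally show "x \<le> K_top l"
    by (simp add: base_def K_top_def)
qed

lemma K_set_less_2: "x \<in> K_set l \<Longrightarrow> x < 2"
  using K_set_bounds(2) K_top_bounds(2) by (rule le_less_trans)

text \<open>A coinduction principle. Iterating the step produces digits; the remainder after
  \<open>n\<close> of them stays in the bounded set \<open>Y\<close> and enters divided by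
  \<open>base l ^ n\<close>, so the expansion converges to the starting point.\<close>

lemma subset_K_setI:
  assumes bdd: "bounded Y"
    and step: "\<And>y. y \<in> Y \<Longrightarrow> \<exists>t\<in>digits_T l. base l * y - real t \<in> Y"
  shows "Y \<subseteq> K_set l"
proof
  fix x assume x: "x \<in> Y"
  define f where "f y = (SOME t. t \<in> digits_T l \<and> base l * y - real t \<in> Y)" for y
  define g where "g y = base l * y - real (f y)" for y
  have f: "f y \<in> digits_T l" "g y \<in> Y" if "y \<in> Y" for y
    using someI_ex[of "\<lambda>t. t \<in> digits_T l \<and> base l * y - real t \<in> Y"] step[OF that]
    by (auto simp: f_def g_def)
  have gn: "(g ^^ n) x \<in> Y" for n
    using x f by (induction n) auto
  define e where "e i = f ((g ^^ (i - 1)) x)" for i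
  have e: "\<forall>i\<ge>1. e i \<in> digits_T l"
    using f gn by (auto simp: e_def)
  have b: "base l > 1" using base_ge[of l] by simp
  have part: "(\<Sum>i<n. real (e (Suc i)) / base l ^ Suc i) = x - (g ^^ n) x / base l ^ n" for n
  proof (induction n)
    case (Suc n)
    have "(g ^^ Suc n) x = base l * (g ^^ n) x - real (e (Suc n))"
      using g_def[of "(g ^^ n) x"] by (simp add: e_def)
    then have "(g ^^ Suc n) x / base l ^ Suc n = (g ^^ n) x / base l ^ n - real (e (Suc n)) / base l ^ Suc n"
      using b by (simp add: diff_divide_distrib)
    then show ?case using Suc.IH by (simp del: funpow.simps power_Suc)
  qed simp
  obtain B where B: "\<And>y. y \<in> Y \<Longrightarrow> norm y \<le> B"
    using bdd by (auto simp: bounded_iff)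
  have "(\<lambda>n. (g ^^ n) x / base l ^ n) \<longlonglongrightarrow> 0"
  proof (rule Lim_null_comparison)
    show "\<forall>\<^sub>F n in sequentially. norm ((g ^^ n) x / base l ^ n) \<le> B * (1 / base l) ^ n"
      using B[OF gn] b by (intro always_eventually allI) (simp add: power_divide divide_right_mono)
    show "(\<lambda>n. B * (1 / base l) ^ n) \<longlonglongrightarrow> 0"
      using b by (intro tendsto_mult_right_zero LIMSEQ_power_zero) auto
  qed
  then have "(\<lambda>n. x - (g ^^ n) x / base l ^ n) \<longlonglongrightarrow> x - 0"
    by (intro tendsto_diff tendsto_const)
  then have "(\<lambda>i. real (e (Suc i)) / base l ^ Suc i) sums x"
    unfolding sums_def part by simp
  then have "x = expansion l e"
    unfolding expansion_def by (rule sums_unique)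
  then show "x \<in> K_set l" using e unfolding K_set_iff by blast
qed

lemma zero_in_K_set: "0 \<in> K_set l"
  using subset_K_setI[of "{0}" l] zero_in_digits_T[of l] by force

lemma bounded_K_set: "bounded (K_set l)"
  by (rule boundedI[of _ 2]) (use K_set_bounds(1) K_set_less_2 in fastforce)

text \<open>Splitting off a digit puts \<open>K_set l\<close> into a finite union of preimages of
  its closure. This union is closed, so it contains the closure too, and
  \<open>subset_K_setI\<close> applies to the closure.\<close>

lemma compact_K_set: "compact (K_set l)"
proof -
  have "closure (K_set l) \<subseteq> K_set l"
  proof (rule subset_K_setI)
    fix y assume y: "y \<in> closure (K_set l)"
    define U where "U = (\<Union>t\<in>digits_T l. (\<lambda>x. base l * x - real t) -` closure (K_set l))"
    have "K_set l \<subseteq> U"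
    proof
      fix x assume "x \<in> K_set l"
      then obtain t where "t \<in> digits_T l" "base l * x - real t \<in> K_set l"
        by (rule K_set_uncons)
      then show "x \<in> U" unfolding U_def using closure_subset[of "K_set l"] by blast
    qed
    moreover have "closed U"
      unfolding U_def
    proof (intro closed_UN finite_digits_T ballI continuous_closed_vimage closed_closure)
      show "isCont (\<lambda>x. base l * x - real t) y" for t y by (intro continuous_intros)
    qed
    ultimately have "closure (K_set l) \<subseteq> U" by (rule closure_minimal)
    then show "\<exists>t\<in>digits_T l. base l * y - real t \<in> closure (K_set l)"
      using y unfolding U_def by blast
  qed (simp add: bounded_K_set bounded_closure)
  then show ?thesis
    using bounded_K_set by (simp add: compact_eq_bounded_closed closure_subset_eq)
qed

text \<open>Reflection replaces each digit \<open>t\<close> by \<open>4 * l + 1 - t\<close>, which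
  is again a digit.\<close>

lemma K_set_reflect:
  assumes "x \<in> K_set l"
  shows "K_top l - x \<in> K_set l"
proof -
  have "(\<lambda>x. K_top l - x) ` K_set l \<subseteq> K_set l"
  proof (rule subset_K_setI)
    show "bounded ((\<lambda>x. K_top l - x) ` K_set l)"
      using bounded_minus_comp[of "\<lambda>_. K_top l" "K_set l" "\<lambda>x. x"] bounded_K_set[of l]
      by (simp add: image_constant_conv)
    fix y assume "y \<in> (\<lambda>x. K_top l - x) ` K_set l"
    then obtain x where x: "x \<in> K_set l" "y = K_top l - x" by auto
    obtain t where t: "t \<in> digits_T l" "base l * x - real t \<in> K_set l"
      using K_set_uncons[OF x(1)] by blast
    have "base l * K_top l = K_top l + real (4 * l + 1)"
      by (simp add: K_top_def base_def field_simps)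
    then have "base l * y - real (4 * l + 1 - t) = K_top l - (base l * x - real t)"
      using digits_T_le[OF t(1)] by (simp add: x(2) algebra_simps of_nat_diff)
    then show "\<exists>t\<in>digits_T l. base l * y - real t \<in> (\<lambda>x. K_top l - x) ` K_set l"
      using t reflect_digits_T[OF t(1)] by (intro bexI[of _ "4 * l + 1 - t"]) auto
  qed
  then show ?thesis using assms by auto
qed

section \<open>Magnification, interior points and regularity\<close>

text \<open>The integers written with \<open>n\<close> digits from \<open>digits_T l\<close> in base
  \<open>2 * l + 2\<close>.\<close>

fun K_prefixes :: "nat \<Rightarrow> nat \<Rightarrow> nat set" where
  "K_prefixes l 0 = {0}"
| "K_prefixes l (Suc n) = (\<Union>d\<in>K_prefixes l n. (\<lambda>t. (2 * l + 2) * d + t) ` digits_T l)"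

lemma K_set_prefix:
  "x \<in> K_set l \<longleftrightarrow> (\<exists>d\<in>K_prefixes l n. base l ^ n * x - real d \<in> K_set l)"
proof (induction n)
  case (Suc n)
  have b: "base l > 0" using base_ge[of l] by simp
  have eq: "y - real ((2 * l + 2) * d + t) = base l * (y / base l - real d) - real t" for y d t
    using b by (simp add: base_def field_simps)
  have "(\<exists>t\<in>digits_T l. base l ^ Suc n * x - real ((2 * l + 2) * d + t) \<in> K_set l) \<longleftrightarrow>
      base l ^ n * x - real d \<in> K_set l" for d
  proof -
    have "base l ^ Suc n * x / base l = base l ^ n * x" using b by simp
    then have "(\<exists>t\<in>digits_T l. base l ^ Suc n * x - real ((2 * l + 2) * d + t) \<in> K_set l) \<longleftrightarrow>
        (\<exists>t\<in>digits_T l. base l * (base l ^ n * x - real d) - real t \<in> K_set l)"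
      unfolding eq by simp
    also have "\<dots> \<longleftrightarrow> base l ^ n * x - real d \<in> K_set l"
    proof
      assume "\<exists>t\<in>digits_T l. base l * (base l ^ n * x - real d) - real t \<in> K_set l"
      then obtain t where "t \<in> digits_T l" "base l * (base l ^ n * x - real d) - real t \<in> K_set l" by blast
      from K_set_Cons[OF this] show "base l ^ n * x - real d \<in> K_set l" using b by simp
    next
      assume "base l ^ n * x - real d \<in> K_set l"
      then obtain t where "t \<in> digits_T l" "base l * (base l ^ n * x - real d) - real t \<in> K_set l"
        by (rule K_set_uncons)
      then show "\<exists>t\<in>digits_T l. base l * (base l ^ n * x - real d) - real t \<in> K_set l" by blast
    qed
    finally show ?thesis .
  qed
  then show ?case by (simp add: Suc.IH)
qed simp

text \<open>Before each division by the base, the integer shift \<open>z\<close> is split into a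
  digit \<open>t\<close> of the same residue, absorbed by \<open>K_set l\<close>, and a multiple of
  the base, which becomes the new shift.\<close>

lemma adic_in_K_set_plus_int:
  fixes j :: int
  shows "\<exists>z::int. of_int j / base l ^ n - of_int z \<in> K_set l"
proof (induction n)
  case 0
  then show ?case using zero_in_K_set by (intro exI[of _ j]) simp
next
  case (Suc n)
  then obtain z :: int where z: "of_int j / base l ^ n - of_int z \<in> K_set l" by blast
  obtain t q where t: "t \<in> digits_T l" "z = int t + int (2 * l + 2) * q"
    using digits_T_residue by blast
  have b: "base l > 0" using base_ge[of l] by simp
  have "of_int z = real t + base l * of_int q" by (simp add: t(2) base_def)
  then have "of_int j / base l ^ Suc n - of_int q = (of_int j / base l ^ n - of_int z + real t) / base l"
    using b by (simp add: field_simps)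
  then show ?case using K_set_Cons[OF t(1) z] by metis
qed

text \<open>Finitely many integer translates form a closed set that contains a dense subset of the
  unit interval, hence the interval. A finite union of closed sets with empty interior could not do
  this.\<close>

lemma interior_K_set_nonempty: "interior (K_set l) \<noteq> {}"
proof
  assume empty: "interior (K_set l) = {}"
  define U where "U A = (\<Union>z\<in>A. (\<lambda>x. of_int z + x) ` K_set l)" for A :: "int set"
  have closed: "closed (U A)" if "finite A" for A
    unfolding U_def using that compact_K_set by (intro closed_UN) (auto intro: closed_translation compact_imp_closed)
  have "interior (U A) = {}" if "finite A" for A
    using that
  proof induction
    case (insert z A)
    have "interior (U A \<union> (\<lambda>x. of_int z + x) ` K_set l) = interior (U A)"
      using closed insert.hyps empty
      by (intro interior_closed_Un_empty_interior) (auto simp: interior_translation)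
    then show ?case using insert.IH by (simp add: U_def Un_commute)
  qed (simp add: U_def)
  \<comment> \<open>Since \<open>K_set l\<close> lies between 0 and 2, these shifts include all that
    reach into the unit interval.\<close>
  moreover have "{0<..<1} \<subseteq> U {-2..1}"
  proof
    fix x :: real assume x: "x \<in> {0<..<1}"
    have b: "base l > 1" using base_ge[of l] by simp
    have "x \<in> closure (U {-2..1})"
      unfolding closure_approachable
    proof (intro allI impI)
      fix e :: real assume "e > 0"
      then obtain n where n: "(1 / base l) ^ n < min e (min x (1 - x))"
        using real_arch_pow_inv[of "min e (min x (1 - x))" "1 / base l"] b x by auto
      define y where "y = of_int \<lfloor>x * base l ^ n\<rfloor> / base l ^ n"
      have bn: "base l ^ n > 0" using b by simp
      have "y \<le> x"
        unfolding y_def using bn by (simp add: pos_divide_le_eq)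
      moreover have "x < (of_int \<lfloor>x * base l ^ n\<rfloor> + 1) / base l ^ n"
        using bn floor_correct[of "x * base l ^ n"] by (simp add: pos_less_divide_eq)
      ultimately have "y \<le> x" "x < y + 1 / base l ^ n"
        unfolding y_def by (simp_all add: add_divide_distrib)
      then have y: "\<bar>y - x\<bar> < min e (min x (1 - x))" using n by (simp add: power_divide)
      obtain z where z: "y - of_int z \<in> K_set l"
        using adic_in_K_set_plus_int unfolding y_def by blast
      have "0 < y" "y < 1" using y x by auto
      then have "z \<in> {-2..1}" using K_set_bounds(1)[OF z] K_set_less_2[OF z] by auto
      then have "y \<in> U {-2..1}" unfolding U_def using z by (intro UN_I[of z] image_eqI) auto
      then show "\<exists>y\<in>U {-2..1}. dist y x < e" using y by (auto simp: dist_real_def)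
    qed
    then show "x \<in> U {-2..1}" using closed[of "{-2..1}"] by simp
  qed
  then have "{0<..<1} \<subseteq> interior (U {-2..1})" by (intro interior_maximal) auto
  moreover have "(1/2 :: real) \<in> {0<..<1}" by simp
  ultimately show False by blast
qed

text \<open>Each point lies in arbitrarily small copies of \<open>K_set l\<close>, and every copy
  contains a scaled copy of one fixed ball.\<close>

lemma K_set_regular: "K_set l = closure (interior (K_set l))"
proof
  show "closure (interior (K_set l)) \<subseteq> K_set l"
    using compact_K_set[of l] by (meson closure_minimal compact_imp_closed interior_subset)
  show "K_set l \<subseteq> closure (interior (K_set l))"
  proof
    fix x assume x: "x \<in> K_set l"
    have b: "base l > 1" using base_ge[of l] by simp
    obtain y r where y: "r > 0" "ball y r \<subseteq> K_set l"
      using interior_K_set_nonempty[of l] by (auto simp: mem_interior)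
    show "x \<in> closure (interior (K_set l))"
      unfolding closure_approachable
    proof (intro allI impI)
      fix e :: real assume "e > 0"
      then obtain n where n: "(1 / base l) ^ n < e / 2"
        using real_arch_pow_inv[of "e / 2" "1 / base l"] b by auto
      define B where "B = base l ^ n"
      have B: "B > 0" "2 / B < e" using b n by (auto simp: B_def power_divide field_simps)
      obtain d where d: "d \<in> K_prefixes l n" "B * x - real d \<in> K_set l"
        using x K_set_prefix[of x l n] by (auto simp: B_def)
      \<comment> \<open>The image of the centre \<open>y\<close> in the copy of
        \<open>K_set l\<close> with prefix \<open>d\<close>, which contains
        \<open>x\<close>.\<close>
      define v where "v = (y + real d) / B"
      have "ball v (r / B) \<subseteq> K_set l"
      proof
        fix u assume "u \<in> ball v (r / B)"
        then have "\<bar>v - u\<bar> * B < r" using B by (simp add: dist_real_def field_simps)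
        moreover have "\<bar>v - u\<bar> * B = \<bar>y - (B * u - real d)\<bar>"
        proof -
          have "\<bar>v - u\<bar> * B = \<bar>(v - u) * B\<bar>" using B by (simp add: abs_mult)
          also have "(v - u) * B = y - (B * u - real d)" using B by (simp add: v_def field_simps)
          finally show ?thesis .
        qed
        ultimately have "B * u - real d \<in> K_set l" using y(2) by (auto simp: dist_real_def)
        then show "u \<in> K_set l" using d(1) K_set_prefix[of u l n] by (auto simp: B_def)
      qed
      then have "v \<in> interior (K_set l)" using y(1) B by (auto simp: mem_interior intro!: exI[of _ "r / B"])
      moreover have "dist v x < e"
      proof -
        have "y \<in> K_set l" using y by auto
        then have "\<bar>y - (B * x - real d)\<bar> < 2"
          using K_set_bounds(1)[OF d(2)] K_set_less_2[OF d(2)] K_set_bounds(1)[of y l] K_set_less_2[of y l] by auto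
        moreover have "v - x = (y - (B * x - real d)) / B" using B by (simp add: v_def field_simps)
        ultimately have "\<bar>v - x\<bar> < 2 / B" using B by (simp add: divide_strict_right_mono)
        then show ?thesis using B by (simp add: dist_real_def)
      qed
      ultimately show "\<exists>y\<in>interior (K_set l). dist y x < e" by blast
    qed
  qed
qed

section \<open>Absence of local half-lines\<close>

text \<open>A first digit 0 would leave a remainder above \<open>K_top l\<close>, a first digit of
  at least 2 a negative one, and 1 is not a digit because \<open>l \<ge> 1\<close>.\<close>

lemma K_set_gap:
  assumes "l \<ge> 1" "K_top l < base l * x" "base l * x < 2"
  shows "x \<notin> K_set l"
proof
  assume "x \<in> K_set l"
  then obtain t where t: "t \<in> digits_T l" "base l * x - real t \<in> K_set l" by (rule K_set_uncons)
  have "t \<noteq> 1" using t(1) assms(1) by (auto simp: digits_T_def)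
  then have "t = 0 \<or> t \<ge> 2" by auto
  then show False
    using K_set_bounds[OF t(2)] assms by (auto simp: K_top_def)
qed

text \<open>Magnify a right half-line at \<open>p\<close> by \<open>base l ^ n\<close>. Then \<open>base l ^ n * p\<close> is a prefix \<open>d\<close>,
  and no other prefix contributes to the unit interval right of \<open>d\<close>, which contains a gap of
  \<open>d + K_set l\<close>.\<close>

lemma K_set_no_right_half_line:
  assumes l: "l \<ge> 1" and p: "p \<in> K_set l" and e: "e > 0"
  shows "\<not> ({p - e<..<p} \<inter> K_set l = {} \<and> {p<..<p + e} \<subseteq> K_set l)"
proof
  assume A: "{p - e<..<p} \<inter> K_set l = {} \<and> {p<..<p + e} \<subseteq> K_set l"
  have b: "base l > 1" using base_ge[of l] by simp
  \<comment> \<open>The prefixes used below are greater than \<open>B * p - 2\<close>; the margin 3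
    guarantees that, scaled back, they stay within \<open>e\<close> of \<open>p\<close> on the
    left.\<close>
  obtain n where n: "(1 / base l) ^ n < e / 3"
    using real_arch_pow_inv[of "e / 3" "1 / base l"] b e by auto
  define B where "B = base l ^ n"
  have B: "B > 0" "3 < e * B" using b n by (auto simp: B_def power_divide field_simps)
  have prefix: "real d / B \<in> K_set l" if "d \<in> K_prefixes l n" for d
  proof -
    have "B * (real d / B) - real d \<in> K_set l" using B zero_in_K_set by simp
    then show ?thesis unfolding K_set_prefix[of "real d / B" l n] using that B_def by blast
  qed
  have low: "B * p \<le> real d" if "d \<in> K_prefixes l n" "B * p - 3 < real d" for d
  proof (rule ccontr)
    assume "\<not> B * p \<le> real d"
    then have "real d / B < p" using B by (simp add: field_simps)
    moreover have "p - e < real d / B"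
    proof -
      have "(p - e) * B < real d" using that(2) B by (simp add: algebra_simps)
      then show ?thesis using B by (simp add: pos_less_divide_eq)
    qed
    ultimately show False using A prefix[OF that(1)] by auto
  qed
  obtain d where d: "d \<in> K_prefixes l n" "B * p - real d \<in> K_set l"
    using p K_set_prefix[of p l n] by (auto simp: B_def)
  have "B * p = real d"
    using low[OF d(1)] K_set_bounds(1)[OF d(2)] K_set_less_2[OF d(2)] by auto
  note top = K_top_bounds[of l]
  \<comment> \<open>The midpoint of the gap from \<open>K_set_gap\<close>; it is below 1 because the
    base exceeds 2.\<close>
  define x where "x = (K_top l + 2) / (2 * base l)"
  have x: "K_top l < base l * x" "base l * x < 2" using top b by (auto simp: x_def)
  have "base l > 2" using l by (simp add: base_def)
  then have x01: "0 < x" "x < 1" using top by (auto simp: x_def)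
  have "(real d + x) / B \<in> K_set l"
  proof -
    have "p < (real d + x) / B" "(real d + x) / B < p + e"
      using \<open>B * p = real d\<close> x01 B by (auto simp: field_simps)
    then show ?thesis using A by auto
  qed
  moreover have "B * ((real d + x) / B) = real d + x" using B by simp
  ultimately obtain d' where d': "d' \<in> K_prefixes l n" "real d + x - real d' \<in> K_set l"
    using K_set_prefix[of "(real d + x) / B" l n, folded B_def] by auto
  have "real d' \<le> real d + x" "real d + x - real d' < 2"
    using K_set_bounds(1)[OF d'(2)] K_set_less_2[OF d'(2)] by auto
  then have "real d \<le> real d'" "real d' < real d + 1"
    using low[OF d'(1)] \<open>B * p = real d\<close> x01 by auto
  then have "d' = d" by linarith
  then show False using d'(2) K_set_gap[OF l x] by simp
qed

text \<open>The symmetry \<open>K_set_reflect\<close> turns a left half-line at \<open>p\<close>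
  into a right half-line at \<open>K_top l - p\<close>.\<close>

lemma K_set_no_left_half_line:
  assumes l: "l \<ge> 1" and p: "p \<in> K_set l" and e: "e > 0"
  shows "\<not> ({p - e<..<p} \<subseteq> K_set l \<and> {p<..<p + e} \<inter> K_set l = {})"
proof
  assume A: "{p - e<..<p} \<subseteq> K_set l \<and> {p<..<p + e} \<inter> K_set l = {}"
  define q where "q = K_top l - p"
  have iff: "K_top l - x \<in> K_set l \<longleftrightarrow> x \<in> K_set l" for x
    using K_set_reflect[of x l] K_set_reflect[of "K_top l - x" l] by auto
  have "{q - e<..<q} \<inter> K_set l = {}"
  proof (intro equals0I)
    fix x assume x: "x \<in> {q - e<..<q} \<inter> K_set l"
    then have "K_top l - x \<in> {p<..<p + e} \<inter> K_set l" by (auto simp: q_def iff)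
    then show False using A by blast
  qed
  moreover have "{q<..<q + e} \<subseteq> K_set l"
  proof
    fix x assume "x \<in> {q<..<q + e}"
    then have "K_top l - x \<in> {p - e<..<p}" by (auto simp: q_def)
    then show "x \<in> K_set l" using A iff by blast
  qed
  ultimately show False
    using K_set_no_right_half_line[OF l _ e, of q] p by (auto simp: q_def iff)
qed

theorem corollary2:
  fixes l :: nat
  assumes "l \<ge> 1"
  shows "cantorval (K_set l)"
proof -
  interpret cantorval_like "K_set l"
  proof
    show "K_set l \<noteq> {}" using zero_in_K_set by blast
    show "K_set l = closure (interior (K_set l))" by (rule K_set_regular)
  qed (use compact_K_set K_set_no_right_half_line K_set_no_left_half_line assms in blast)+
  show ?thesis by (rule cantorval_X)
qed

end
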